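(* Let $K:[0,1]^2\to\mathbb{R}$, $(t,s)\mapsto K(t,s)$, be continuous and continuously differentiable with respect to $t$. Let $W(t)$, $t\in[0,1]$, be a one-dimensional Wiener process and let $X(t)=\int_0^t K(t,s)\,\mathrm{d}W(s)$, $t\in[0,1]$, be the Volterra Gaussian process generated by the kernel $K(t,s)1_{[0,t]}(s)$. Then $X$ is an integrator.
   Context: A centred Gaussian process $x(t)$, $t\in[0,1]$, with $x(0)=0$ is called an integrator if there exists $c>0$ such that for every $n\ge 1$, all $a_0,\ldots,a_{n-1}\in\mathbb{R}$ and all $0=t_0<t_1<\ldots<t_n=1$, $$\mathsf{E}\Big(\sum_{k=0}^{n-1}a_k\,(x(t_{k+1})-x(t_k))\Big)^2\le c\sum_{k=0}^{n-1}a_k^2\,(t_{k+1}-t_k).$$ "Continuously differentiable with respect to $t$" means that the partial derivative $\partial K/\partial t$ exists and is continuous on $[0,1]^2$ (one-sided at the endpoints $t=0,1$). *)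

theory Defs
  imports "HOL-Probability.Probability"
begin

text \<open>The degenerate normal law, concentrated at 0, counts as Gaussian; it has no density and
  is therefore a separate disjunct.\<close>

definition centred_gaussian :: "'a measure \<Rightarrow> ('a \<Rightarrow> real) \<Rightarrow> bool" where
  "centred_gaussian M Y \<longleftrightarrow>
     (\<exists>\<sigma>>0. distributed M lborel Y (normal_density 0 \<sigma>)) \<or>
     (Y \<in> borel_measurable M \<and> (AE \<omega> in M. Y \<omega> = 0))"

definition centred_gaussian_process ::
    "'a measure \<Rightarrow> real set \<Rightarrow> (real \<Rightarrow> 'a \<Rightarrow> real) \<Rightarrow> bool" where
  "centred_gaussian_process M T x \<longleftrightarrow> prob_space M \<and>
     (\<forall>F a. finite F \<and> F \<subseteq> T \<longrightarrow> centred_gaussian M (\<lambda>\<omega>. \<Sum>t\<in>F. a t * x t \<omega>))"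

text \<open>As usual for processes, \<open>x 0 = 0\<close> is understood almost surely. The Bochner integral
  below is a genuine expectation, since centred Gaussian variables are square integrable.\<close>

definition integrator :: "'a measure \<Rightarrow> (real \<Rightarrow> 'a \<Rightarrow> real) \<Rightarrow> bool" where
  "integrator M x \<longleftrightarrow>
     centred_gaussian_process M {0..1} x \<and>
     (AE \<omega> in M. x 0 \<omega> = 0) \<and>
     (\<exists>c>0. \<forall>n\<ge>1. \<forall>(a :: nat \<Rightarrow> real) (t :: nat \<Rightarrow> real).
        t 0 = 0 \<and> t n = 1 \<and> (\<forall>k<n. t k < t (Suc k)) \<longrightarrow>
          (\<integral>\<omega>. (\<Sum>k<n. a k * (x (t (Suc k)) \<omega> - x (t k) \<omega>))\<^sup>2 \<partial>M)
            \<le> c * (\<Sum>k<n. (a k)\<^sup>2 * (t (Suc k) - t k)))"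

text \<open>Standard one-dimensional Wiener process on the time interval \<open>[0,1]\<close>.\<close>

locale wiener_process = prob_space M for M :: "'a measure" +
  fixes W :: "real \<Rightarrow> 'a \<Rightarrow> real"
  assumes rv: "t \<in> {0..1} \<Longrightarrow> W t \<in> borel_measurable M"
    and start: "AE \<omega> in M. W 0 \<omega> = 0"
    and indep_increments:
      "\<lbrakk>\<forall>k\<le>n. p k \<in> {0..1}; \<forall>k<n. p k < p (Suc k)\<rbrakk>
         \<Longrightarrow> indep_vars (\<lambda>_. borel) (\<lambda>(k::nat) \<omega>. W (p (Suc k)) \<omega> - W (p k) \<omega>) {..<n}"
    and normal_increments:
      "\<lbrakk>0 \<le> s; s < t; t \<le> 1\<rbrakk>
         \<Longrightarrow> distributed M lborel (\<lambda>\<omega>. W t \<omega> - W s \<omega>) (normal_density 0 (sqrt (t - s)))"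
    and continuous_paths: "AE \<omega> in M. continuous_on {0..1} (\<lambda>t. W t \<omega>)"

definition step_fun :: "nat \<Rightarrow> (nat \<Rightarrow> real) \<Rightarrow> (nat \<Rightarrow> real) \<Rightarrow> real \<Rightarrow> real" where
  "step_fun n p c s = (\<Sum>k<n. c k * indicator {p k<..p (Suc k)} s)"

definition step_wiener_integral ::
    "(real \<Rightarrow> 'a \<Rightarrow> real) \<Rightarrow> nat \<Rightarrow> (nat \<Rightarrow> real) \<Rightarrow> (nat \<Rightarrow> real) \<Rightarrow> 'a \<Rightarrow> real" where
  "step_wiener_integral W n p c \<omega> = (\<Sum>k<n. c k * (W (p (Suc k)) \<omega> - W (p k) \<omega>))"

text \<open>The random variable \<open>Y\<close> is (a version of) the Wiener integral of the deterministic
  function \<open>f\<close> over \<open>[a,b]\<close>: the mean-square limit of the integrals of step functions that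
  converge to \<open>f\<close> in \<open>L\<^sup>2[a,b]\<close>. By the Ito isometry \<open>Y\<close> is determined almost surely and does
  not depend on the approximating sequence. The distances are written as nonnegative integrals,
  so that they are infinite (rather than 0) when the integrand is not integrable.\<close>

definition has_wiener_integral ::
    "'a measure \<Rightarrow> (real \<Rightarrow> 'a \<Rightarrow> real) \<Rightarrow> real \<Rightarrow> real \<Rightarrow> (real \<Rightarrow> real) \<Rightarrow> ('a \<Rightarrow> real) \<Rightarrow> bool" where
  "has_wiener_integral M W a b f Y \<longleftrightarrow>
     Y \<in> borel_measurable M \<and>
     set_borel_measurable lborel {a..b} f \<and>
     (\<exists>N p c.
        (\<forall>m. (\<forall>k\<le>N m. p m k \<in> {a..b}) \<and> (\<forall>k<N m. p m k \<le> p m (Suc k))) \<and>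
        (\<lambda>m. \<integral>\<^sup>+s\<in>{a..b}. ennreal ((f s - step_fun (N m) (p m) (c m) s)\<^sup>2) \<partial>lborel) \<longlonglongrightarrow> 0 \<and>
        (\<lambda>m. \<integral>\<^sup>+\<omega>. ennreal ((Y \<omega> - step_wiener_integral W (N m) (p m) (c m) \<omega>)\<^sup>2) \<partial>M)
          \<longlonglongrightarrow> 0)"

end

theory Submission
  imports Defs
begin

text \<open>By the Ito isometry, the second moment of the sum of the increments of \<open>X\<close> weighted by
  \<open>a k\<close> is the squared \<open>L\<^sup>2\<close> norm of the corresponding combination of the kernels. There an
  increment splits into \<open>K (t (k+1)) s\<close> on \<open>(t k, t (k+1)]\<close> and
  \<open>K (t (k+1)) s - K (t k) s\<close> on \<open>[0, t k]\<close>. The first parts have disjoint supports and are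
  controlled by the bound \<open>B\<close> of \<open>K\<close>; the second parts are at most \<open>D\<close> times the length of the
  interval, \<open>D\<close> being a bound of the derivative, and are controlled by the Cauchy-Schwarz
  inequality because the lengths add up to 1. Gaussianity, like the isometry, passes to
  mean-square limits of step integrals through characteristic functions.\<close>

section \<open>Mean-square convergence\<close>

text \<open>Some distance in the sequence is finite, so \<open>f\<close> differs from a square
  integrable function by a square integrable one. Convergence of the second moments then comes from
  a weighted comparison of squares, and almost sure convergence along a subsequence from the
  \<open>L1\<close> convergence of the squared differences to 0.\<close>

lemma L2_limit:
  fixes f :: "'a \<Rightarrow> real"
  assumes [measurable]: "f \<in> borel_measurable M" "\<And>m. g m \<in> borel_measurable M"
    and int_g: "\<And>m. integrable M (\<lambda>x. (g m x)\<^sup>2)"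
    and lim: "(\<lambda>m. \<integral>\<^sup>+x. ennreal ((f x - g m x)\<^sup>2) \<partial>M) \<longlonglongrightarrow> 0"
  shows L2_limit_integrable: "integrable M (\<lambda>x. (f x)\<^sup>2)"
    and L2_limit_integral: "(\<lambda>m. \<integral>x. (g m x)\<^sup>2 \<partial>M) \<longlonglongrightarrow> (\<integral>x. (f x)\<^sup>2 \<partial>M)"
    and L2_limit_AE: "\<exists>r::nat \<Rightarrow> nat. strict_mono r \<and> (AE x in M. (\<lambda>m. g (r m) x) \<longlonglongrightarrow> f x)"
proof -
  have "eventually (\<lambda>m. (\<integral>\<^sup>+x. ennreal ((f x - g m x)\<^sup>2) \<partial>M) < 1) sequentially"
    using lim by (rule order_tendstoD) simp
  then obtain m where m: "(\<integral>\<^sup>+x. ennreal ((f x - g m x)\<^sup>2) \<partial>M) < 1"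
    by (meson eventually_happens trivial_limit_sequentially)
  have int_m: "integrable M (\<lambda>x. (f x - g m x)\<^sup>2)"
    using m order_less_trans[OF m, of \<top>]
    by (intro integrableI_bounded) auto
  have sq_le: "a\<^sup>2 \<le> 2 * (a - b)\<^sup>2 + 2 * b\<^sup>2" for a b :: real
    using zero_le_power2[of "a - 2 * b"] by (simp add: power2_eq_square algebra_simps)
  show int_f: "integrable M (\<lambda>x. (f x)\<^sup>2)"
    by (rule Bochner_Integration.integrable_bound[where f = "\<lambda>x. 2 * (f x - g m x)\<^sup>2 + 2 * (g m x)\<^sup>2"])
       (use int_m int_g sq_le in auto)
  have int_d: "integrable M (\<lambda>x. (f x - g m x)\<^sup>2)" for m
    by (rule Bochner_Integration.integrable_bound[where f = "\<lambda>x. 2 * (f x)\<^sup>2 + 2 * (g m x)\<^sup>2"])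
       (use int_f int_g sq_le[of "f x - g m x" "f x" for x] in \<open>auto simp: add.commute\<close>)
  define \<delta> where "\<delta> m = (\<integral>x. (f x - g m x)\<^sup>2 \<partial>M)" for m
  have "(\<lambda>m. ennreal (\<delta> m)) \<longlonglongrightarrow> ennreal 0"
    using lim unfolding \<delta>_def by (subst (asm) nn_integral_eq_integral) (auto intro: int_d)
  then have \<delta>: "\<delta> \<longlonglongrightarrow> 0"
    by (subst (asm) tendsto_ennreal_iff) (auto simp: \<delta>_def)
  have \<delta>_nonneg: "0 \<le> \<delta> m" for m by (simp add: \<delta>_def)
  let ?I = "\<integral>x. (f x)\<^sup>2 \<partial>M"
  have I_nonneg: "0 \<le> ?I" by simp
  \<comment> \<open>Young's inequality with weight \<epsilon>: the cross term in
    \<open>b\<^sup>2 - a\<^sup>2 = (a - b)\<^sup>2 - 2 * (a * (a - b))\<close> is split so that the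
    part containing \<open>a\<^sup>2\<close> has a small factor, at the price of a large factor on
    the vanishing part.\<close>
  have bound: "\<bar>(\<integral>x. (g m x)\<^sup>2 \<partial>M) - ?I\<bar> \<le> \<epsilon> * ?I + (1 + 1/\<epsilon>) * \<delta> m" if "0 < \<epsilon>" for m \<epsilon>
  proof -
    have pt: "\<bar>b\<^sup>2 - a\<^sup>2\<bar> \<le> \<epsilon> * a\<^sup>2 + (1 + 1/\<epsilon>) * (a - b)\<^sup>2" for a b :: real
    proof -
      have "0 \<le> (\<epsilon> * \<bar>a\<bar> - \<bar>a - b\<bar>)\<^sup>2 / \<epsilon>" using that by simp
      also have "\<dots> = \<epsilon> * \<bar>a\<bar>\<^sup>2 + (1/\<epsilon>) * \<bar>a - b\<bar>\<^sup>2 - 2 * (\<bar>a\<bar> * \<bar>a - b\<bar>)"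
        using that by (simp add: power2_eq_square field_simps)
      finally have *: "\<bar>2 * (a * (a - b))\<bar> \<le> \<epsilon> * a\<^sup>2 + (1/\<epsilon>) * (a - b)\<^sup>2"
        by (simp only: abs_mult power2_abs)
      have "b\<^sup>2 - a\<^sup>2 = (a - b)\<^sup>2 - 2 * (a * (a - b))"
        by (simp add: power2_eq_square algebra_simps)
      then have "\<bar>b\<^sup>2 - a\<^sup>2\<bar> \<le> (a - b)\<^sup>2 + \<bar>2 * (a * (a - b))\<bar>"
        using abs_triangle_ineq4[of "(a - b)\<^sup>2" "2 * (a * (a - b))"] by simp
      with * show ?thesis unfolding distrib_right by linarith
    qed
    have "\<bar>(\<integral>x. (g m x)\<^sup>2 \<partial>M) - ?I\<bar> = \<bar>\<integral>x. (g m x)\<^sup>2 - (f x)\<^sup>2 \<partial>M\<bar>"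
      by (simp add: int_f int_g)
    also have "\<dots> \<le> (\<integral>x. \<bar>(g m x)\<^sup>2 - (f x)\<^sup>2\<bar> \<partial>M)" by (rule integral_abs_bound)
    also have "\<dots> \<le> (\<integral>x. \<epsilon> * (f x)\<^sup>2 + (1 + 1/\<epsilon>) * (f x - g m x)\<^sup>2 \<partial>M)"
      by (intro integral_mono pt) (auto intro!: int_f int_g int_d)
    also have "\<dots> = \<epsilon> * ?I + (1 + 1/\<epsilon>) * \<delta> m"
      by (simp add: int_f int_d \<delta>_def)
    finally show ?thesis .
  qed
  show "(\<lambda>m. \<integral>x. (g m x)\<^sup>2 \<partial>M) \<longlonglongrightarrow> ?I"
  proof (rule LIMSEQ_I)
    fix r :: real assume r: "0 < r"
    \<comment> \<open>Half of \<open>r\<close> is reserved for each of the two terms of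
      \<open>bound\<close>; the \<open>+ 1\<close> keeps the denominator positive when
      \<open>?I\<close> is 0.\<close>
    define \<epsilon> where "\<epsilon> = r / (2 * (?I + 1))"
    have \<epsilon>: "0 < \<epsilon>" using r I_nonneg unfolding \<epsilon>_def by (intro divide_pos_pos mult_pos_pos add_nonneg_pos) auto
    have "\<epsilon> * (?I + 1) = r / 2" using I_nonneg by (simp add: \<epsilon>_def field_simps add_nonneg_eq_0_iff)
    then have le: "\<epsilon> * ?I < r / 2" using \<epsilon> by (simp add: algebra_simps)
    have "(\<lambda>m. (1 + 1/\<epsilon>) * \<delta> m) \<longlonglongrightarrow> (1 + 1/\<epsilon>) * 0" by (intro tendsto_intros \<delta>)
    then have "eventually (\<lambda>m. (1 + 1/\<epsilon>) * \<delta> m < r / 2) sequentially"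
      by (rule order_tendstoD) (use r in simp)
    then obtain N where N: "\<And>m. m \<ge> N \<Longrightarrow> (1 + 1/\<epsilon>) * \<delta> m < r / 2"
      by (auto simp: eventually_sequentially)
    have "norm ((\<integral>x. (g m x)\<^sup>2 \<partial>M) - ?I) < r" if "m \<ge> N" for m
      using bound[OF \<epsilon>, of m] N[OF that] le unfolding real_norm_def by linarith
    then show "\<exists>N. \<forall>m\<ge>N. norm ((\<integral>x. (g m x)\<^sup>2 \<partial>M) - ?I) < r" by blast
  qed
  obtain r :: "nat \<Rightarrow> nat" where r: "strict_mono r" "AE x in M. (\<lambda>m. f x - g (r m) x) \<longlonglongrightarrow> 0"
    using tendsto_L1_AE_subseq[of M "\<lambda>m x. (f x - g m x)\<^sup>2"] int_d \<delta>
    by (auto simp: \<delta>_def[abs_def])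
  have "AE x in M. (\<lambda>m. g (r m) x) \<longlonglongrightarrow> f x"
    using r(2)
  proof eventually_elim
    case (elim x)
    from tendsto_diff[OF tendsto_const[of "f x"] this] show ?case by simp
  qed
  with r(1) show "\<exists>r::nat \<Rightarrow> nat. strict_mono r \<and> (AE x in M. (\<lambda>m. g (r m) x) \<longlonglongrightarrow> f x)" by blast
qed

text \<open>Pointwise Cauchy-Schwarz bounds the squared sum by the fixed finite factor
  \<open>?B\<close> times the sum of the squares. Nonnegative integrals make this meaningful without
  any integrability.\<close>

lemma L2_tendsto_sum:
  fixes Z :: "'i \<Rightarrow> nat \<Rightarrow> 'a \<Rightarrow> real"
  assumes [measurable]: "\<And>i m. i \<in> I \<Longrightarrow> Z i m \<in> borel_measurable M"
    and lim: "\<And>i. i \<in> I \<Longrightarrow> (\<lambda>m. \<integral>\<^sup>+x. ennreal ((Z i m x)\<^sup>2) \<partial>M) \<longlonglongrightarrow> 0"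
  shows "(\<lambda>m. \<integral>\<^sup>+x. ennreal ((\<Sum>i\<in>I. b i * Z i m x)\<^sup>2) \<partial>M) \<longlonglongrightarrow> 0"
proof (rule tendsto_sandwich[OF _ _ tendsto_const])
  let ?B = "\<Sum>i\<in>I. (b i)\<^sup>2"
  have "(\<integral>\<^sup>+x. ennreal ((\<Sum>i\<in>I. b i * Z i m x)\<^sup>2) \<partial>M)
      \<le> ennreal ?B * (\<Sum>i\<in>I. \<integral>\<^sup>+x. ennreal ((Z i m x)\<^sup>2) \<partial>M)" for m
  proof -
    have "(\<integral>\<^sup>+x. ennreal ((\<Sum>i\<in>I. b i * Z i m x)\<^sup>2) \<partial>M)
        \<le> (\<integral>\<^sup>+x. ennreal ?B * (\<Sum>i\<in>I. ennreal ((Z i m x)\<^sup>2)) \<partial>M)"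
      by (intro nn_integral_mono)
         (simp add: sum_nonneg ennreal_mult[symmetric] Cauchy_Schwarz_ineq_sum ennreal_leI)
    also have "\<dots> = ennreal ?B * (\<Sum>i\<in>I. \<integral>\<^sup>+x. ennreal ((Z i m x)\<^sup>2) \<partial>M)"
      by (simp add: nn_integral_cmult nn_integral_sum del: sum_ennreal)
    finally show ?thesis .
  qed
  then show "\<forall>\<^sub>F m in sequentially. (\<integral>\<^sup>+x. ennreal ((\<Sum>i\<in>I. b i * Z i m x)\<^sup>2) \<partial>M)
      \<le> ennreal ?B * (\<Sum>i\<in>I. \<integral>\<^sup>+x. ennreal ((Z i m x)\<^sup>2) \<partial>M)" by simp
  have "(\<lambda>m. ennreal ?B * (\<Sum>i\<in>I. \<integral>\<^sup>+x. ennreal ((Z i m x)\<^sup>2) \<partial>M))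
      \<longlonglongrightarrow> ennreal ?B * (\<Sum>i\<in>I. 0)"
    by (intro ennreal_tendsto_cmult tendsto_sum lim) auto
  then show "(\<lambda>m. ennreal ?B * (\<Sum>i\<in>I. \<integral>\<^sup>+x. ennreal ((Z i m x)\<^sup>2) \<partial>M)) \<longlonglongrightarrow> 0"
    by simp
qed simp

section \<open>Centred Gaussian laws and their mean-square limits\<close>

text \<open>Both the second moment and the characteristic function are stable under mean-square
  limits, so recording them together carries the isometry and Gaussianity through one limit
  argument. The value \<open>v = 0\<close> covers the degenerate law, so sequences whose variances
  tend to 0 need no separate treatment.\<close>

definition gaussian_law :: "'a measure \<Rightarrow> ('a \<Rightarrow> real) \<Rightarrow> real \<Rightarrow> bool" where
  "gaussian_law M Y v \<longleftrightarrow> Y \<in> borel_measurable M \<and> integrable M (\<lambda>\<omega>. (Y \<omega>)\<^sup>2) \<and>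
     (\<integral>\<omega>. (Y \<omega>)\<^sup>2 \<partial>M) = v \<and>
     (\<forall>x. (CLINT \<omega>|M. iexp (x * Y \<omega>)) = of_real (exp (- v * x\<^sup>2 / 2)))"

context prob_space
begin

lemma gaussian_law_normal:
  assumes \<sigma>: "0 < \<sigma>" and D: "distributed M lborel Y (normal_density 0 \<sigma>)"
  shows "gaussian_law M Y (\<sigma>\<^sup>2)"
proof -
  have Y[measurable]: "Y \<in> borel_measurable M" using distributed_measurable[OF D] by simp
  have "integrable M (\<lambda>\<omega>. (Y \<omega>)\<^sup>2)"
    using distributed_integrable[OF D, of "\<lambda>x. x\<^sup>2"] integrable_normal_moment[OF \<sigma>, of 0 2] by simp
  moreover have "(\<integral>\<omega>. (Y \<omega>)\<^sup>2 \<partial>M) = \<sigma>\<^sup>2"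
    using normal_distributed_variance[OF \<sigma> D] normal_distributed_expectation[OF \<sigma> D] by simp
  moreover have "(CLINT \<omega>|M. iexp (x * Y \<omega>)) = of_real (exp (- \<sigma>\<^sup>2 * x\<^sup>2 / 2))" for x
  proof -
    \<comment> \<open>The characteristic function of \<open>Y\<close> at \<open>x\<close> is that of
      the standardised variable at \<open>x * \<sigma>\<close>.\<close>
    have S: "distributed M lborel (\<lambda>\<omega>. Y \<omega> / \<sigma>) std_normal_density"
      using D normal_standard_normal_convert[OF \<sigma>, of Y 0] by simp
    have "distr M borel (\<lambda>\<omega>. Y \<omega> / \<sigma>) = std_normal_distribution"
      using distributed_distr_eq_density[OF S] by (metis distr_cong sets_lborel)
    then have "char (distr M borel (\<lambda>\<omega>. Y \<omega> / \<sigma>)) (x * \<sigma>) = exp (- ((x * \<sigma>)\<^sup>2) / 2)"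
      by (simp add: char_std_normal_distribution)
    moreover have "char (distr M borel (\<lambda>\<omega>. Y \<omega> / \<sigma>)) (x * \<sigma>) = (CLINT \<omega>|M. iexp (x * Y \<omega>))"
      unfolding char_def using \<sigma> by (subst integral_distr) auto
    ultimately show ?thesis by (simp add: power_mult_distrib mult.commute)
  qed
  ultimately show ?thesis by (simp add: gaussian_law_def)
qed

lemma gaussian_law_zero: "gaussian_law M (\<lambda>_. 0) 0"
proof -
  have "(CLINT \<omega>|M. iexp (x * 0)) = of_real (exp (- 0 * x\<^sup>2 / 2))" for x
    by (simp only: mult_zero_right of_real_0 exp_zero lebesgue_integral_const prob_space scaleR_one) simp
  then show ?thesis by (simp add: gaussian_law_def)
qed

text \<open>A vanishing second moment forces \<open>Y\<close> to be 0 almost surely. Otherwise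
  \<open>Y / sqrt v\<close> has the standard normal characteristic function, and Levy's uniqueness
  theorem identifies its law.\<close>

lemma gaussian_law_imp_centred_gaussian:
  assumes Y: "gaussian_law M Y v"
  shows "centred_gaussian M Y"
proof -
  have Ym[measurable]: "Y \<in> borel_measurable M" using Y by (simp add: gaussian_law_def)
  have v: "(\<integral>\<omega>. (Y \<omega>)\<^sup>2 \<partial>M) = v" "integrable M (\<lambda>\<omega>. (Y \<omega>)\<^sup>2)" using Y by (auto simp: gaussian_law_def)
  then have "0 \<le> v" by auto
  then consider "v = 0" | "0 < v" by linarith
  then show ?thesis
  proof cases
    case 1
    then have "AE \<omega> in M. Y \<omega> = 0"
      using v integral_nonneg_eq_0_iff_AE[OF v(2)] by simp
    then show ?thesis by (simp add: centred_gaussian_def)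
  next
    case 2
    define \<sigma> where "\<sigma> = sqrt v"
    have \<sigma>: "0 < \<sigma>" "\<sigma>\<^sup>2 = v" using 2 by (auto simp: \<sigma>_def)
    let ?Z = "\<lambda>\<omega>. Y \<omega> / \<sigma>"
    have "char (distr M borel ?Z) x = char std_normal_distribution x" for x
    proof -
      have "char (distr M borel ?Z) x = (CLINT \<omega>|M. iexp ((x / \<sigma>) * Y \<omega>))"
        unfolding char_def by (subst integral_distr) auto
      also have "\<dots> = of_real (exp (- v * (x / \<sigma>)\<^sup>2 / 2))"
        using Y by (simp only: gaussian_law_def)
      also have "\<dots> = of_real (exp (- x\<^sup>2 / 2))"
        using \<sigma> 2 by (simp add: power_divide)
      finally show ?thesis by (simp add: char_std_normal_distribution)
    qed
    then have "distr M borel ?Z = std_normal_distribution"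
      by (intro Levy_uniqueness real_distribution_distr real_dist_normal_dist) auto
    then have "distributed M lborel ?Z std_normal_density"
      by (auto simp: distributed_def cong: distr_cong)
    then have "distributed M lborel Y (normal_density 0 \<sigma>)"
      using normal_standard_normal_convert[OF \<sigma>(1), of Y 0] by simp
    then show ?thesis using \<sigma>(1) by (auto simp: centred_gaussian_def)
  qed
qed

text \<open>Along an almost surely convergent subsequence the characteristic functions converge by
  dominated convergence, since \<open>iexp\<close> has modulus 1 on the reals. The variances
  converge along the whole sequence, hence to the same limit along the subsequence.\<close>

lemma gaussian_law_L2_limit:
  assumes Y[measurable]: "Y \<in> borel_measurable M"
    and S: "\<And>m. gaussian_law M (S m) (v m)"
    and lim: "(\<lambda>m. \<integral>\<^sup>+\<omega>. ennreal ((Y \<omega> - S m \<omega>)\<^sup>2) \<partial>M) \<longlonglongrightarrow> 0"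
    and v: "v \<longlonglongrightarrow> v'"
  shows "gaussian_law M Y v'"
proof -
  have [measurable]: "S m \<in> borel_measurable M" for m using S by (simp add: gaussian_law_def)
  have int_S: "integrable M (\<lambda>\<omega>. (S m \<omega>)\<^sup>2)" for m using S by (simp add: gaussian_law_def)
  have v_eq: "v m = (\<integral>\<omega>. (S m \<omega>)\<^sup>2 \<partial>M)" for m using S by (simp add: gaussian_law_def)
  note L2 = Y \<open>\<And>m. S m \<in> borel_measurable M\<close> int_S lim
  have "(\<integral>\<omega>. (Y \<omega>)\<^sup>2 \<partial>M) = v'"
    using L2_limit_integral[OF L2] v unfolding v_eq by (rule LIMSEQ_unique)
  moreover have "(CLINT \<omega>|M. iexp (x * Y \<omega>)) = of_real (exp (- v' * x\<^sup>2 / 2))" for x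
  proof -
    obtain r :: "nat \<Rightarrow> nat" where r: "strict_mono r" "AE \<omega> in M. (\<lambda>m. S (r m) \<omega>) \<longlonglongrightarrow> Y \<omega>"
      using L2_limit_AE[OF L2] by blast
    have "(\<lambda>m. CLINT \<omega>|M. iexp (x * S (r m) \<omega>)) \<longlonglongrightarrow> (CLINT \<omega>|M. iexp (x * Y \<omega>))"
    proof (rule integral_dominated_convergence[where w = "\<lambda>_. 1"])
      show "AE \<omega> in M. (\<lambda>m. iexp (x * S (r m) \<omega>)) \<longlonglongrightarrow> iexp (x * Y \<omega>)"
        using r(2) by eventually_elim (auto intro!: tendsto_intros)
    qed (auto simp flip: of_real_mult)
    moreover have "(CLINT \<omega>|M. iexp (x * S (r m) \<omega>)) = of_real (exp (- v (r m) * x\<^sup>2 / 2))" for m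
      using S by (simp only: gaussian_law_def)
    moreover have "(\<lambda>m. complex_of_real (exp (- v (r m) * x\<^sup>2 / 2))) \<longlonglongrightarrow> of_real (exp (- v' * x\<^sup>2 / 2))"
      using LIMSEQ_subseq_LIMSEQ[OF v r(1)] unfolding comp_def by (intro tendsto_intros) auto
    ultimately show ?thesis by (simp add: LIMSEQ_unique)
  qed
  ultimately show ?thesis
    using L2_limit_integrable[OF L2] by (simp add: gaussian_law_def)
qed

end


section \<open>Partitions, step functions and sums of independent normal variables\<close>

lemma mono_upto:
  fixes r :: "nat \<Rightarrow> 'a::order"
  assumes "\<And>k. k < n \<Longrightarrow> r k \<le> r (Suc k)" "i \<le> j" "j \<le> n"
  shows "r i \<le> r j"
  using assms(2,3)
proof (induction j rule: dec_induct)
  case (step k)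
  then have "r i \<le> r k" "r k \<le> r (Suc k)" using assms(1) by simp_all
  then show ?case by (rule order_trans)
qed simp

text \<open>The half-open cells are pairwise disjoint, neighbouring ones included, so all cross
  terms vanish. Weak monotonicity of \<open>r\<close> only adds empty cells.\<close>

lemma sum_indicator_power2:
  fixes e r :: "nat \<Rightarrow> real"
  assumes "\<And>k. k < n \<Longrightarrow> r k \<le> r (Suc k)"
  shows "(\<Sum>k<n. e k * indicator {r k<..r (Suc k)} s)\<^sup>2
       = (\<Sum>k<n. (e k)\<^sup>2 * indicator {r k<..r (Suc k)} s)"
  using assms
proof (induction n)
  case (Suc n)
  let ?S = "\<Sum>k<n. e k * indicator {r k<..r (Suc k)} s"
  let ?i = "indicator {r n<..r (Suc n)} s :: real"
  have "?S * ?i = 0"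
  proof (cases "s \<in> {r n<..r (Suc n)}")
    case True
    have "r (Suc k) \<le> r n" if "k < n" for k
      by (rule mono_upto[of n r "Suc k" n]) (use that Suc.prems in simp_all)
    with True have "?S = 0" by (intro sum.neutral) (force simp: indicator_def)
    then show ?thesis by simp
  qed simp
  moreover have "?i\<^sup>2 = ?i" by (simp add: indicator_def)
  ultimately show ?case using Suc by (auto simp: power2_sum power_mult_distrib)
qed simp

text \<open>The points of \<open>P\<close> are listed increasingly and the increment of
  \<open>g\<close> from \<open>u\<close> to \<open>v\<close> telescopes over the cells between them,
  which the factor \<open>of_bool\<close> selects. The selection does not depend on
  \<open>g\<close>, so a single refinement serves random increments and indicator functions at
  once.\<close>

lemma finite_refinement:
  fixes P :: "real set"
  assumes P: "finite P" "P \<noteq> {}"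
  obtains n r where "\<And>k. k \<le> n \<Longrightarrow> r k \<in> P" "\<And>k. k < n \<Longrightarrow> r k < r (Suc k)"
    "\<And>u v (g :: real \<Rightarrow> real). u \<in> P \<Longrightarrow> v \<in> P \<Longrightarrow> u \<le> v \<Longrightarrow>
       g v - g u = (\<Sum>k<n. of_bool (u \<le> r k \<and> r k < v) * (g (r (Suc k)) - g (r k)))"
proof -
  define xs where "xs = sorted_list_of_set P"
  define n where "n = length xs - 1"
  have xs: "set xs = P" "sorted_wrt (<) xs" using P by (auto simp: xs_def)
  have n: "k < length xs \<longleftrightarrow> k \<le> n" for k
    using P xs(1) by (cases xs) (auto simp: n_def)
  have less: "xs ! i < xs ! j \<longleftrightarrow> i < j" if "i \<le> n" "j \<le> n" for i j
    using that xs(2) unfolding n[symmetric]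
    by (metis linorder_neqE_nat order_less_asym order_less_irrefl sorted_wrt_iff_nth_less)
  have le: "xs ! i \<le> xs ! j \<longleftrightarrow> i \<le> j" if "i \<le> n" "j \<le> n" for i j
    using less[of j i] that by (metis linorder_not_less)
  show thesis
  proof (rule that[of n "\<lambda>k. xs ! k"])
    fix u v and g :: "real \<Rightarrow> real" assume uv: "u \<in> P" "v \<in> P" "u \<le> v"
    then obtain i j where ij: "i \<le> n" "j \<le> n" "u = xs ! i" "v = xs ! j"
      by (metis in_set_conv_nth n xs(1))
    then have "i \<le> j" using le uv by simp
    have "(\<Sum>k<n. of_bool (u \<le> xs ! k \<and> xs ! k < v) * (g (xs ! Suc k) - g (xs ! k)))
        = (\<Sum>k\<in>{i..<j}. g (xs ! Suc k) - g (xs ! k))"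
      by (rule sum.mono_neutral_cong_right) (use ij in \<open>auto simp: le less\<close>)
    also have "\<dots> = g v - g u"
      using sum_Suc_diff'[OF \<open>i \<le> j\<close>, of "\<lambda>k. g (xs ! k)"] ij by simp
    finally show "g v - g u
        = (\<Sum>k<n. of_bool (u \<le> xs ! k \<and> xs ! k < v) * (g (xs ! Suc k) - g (xs ! k)))" by simp
  qed (use xs(1) less nth_mem n in blast, simp add: less)
qed

text \<open>For fixed \<open>s\<close> this presents the indicator of an interval as an increment of
  the function \<open>indicator {s..}\<close> of its endpoints, the form to which
  \<open>finite_refinement\<close> applies.\<close>

lemma indicator_greaterThanAtMost_eq_diff:
  fixes u v s :: real
  assumes "u \<le> v"
  shows "(indicator {u<..v} s :: real) = indicator {s..} v - indicator {s..} u"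
  using assms by (auto simp: indicator_def)

lemma integral_sum_indicator_power2:
  fixes e r :: "nat \<Rightarrow> real"
  assumes r: "\<And>k. k < n \<Longrightarrow> r k \<le> r (Suc k)"
  shows "integrable lborel (\<lambda>s. (\<Sum>k<n. e k * indicator {r k<..r (Suc k)} s)\<^sup>2)"
    and "(\<integral>s. (\<Sum>k<n. e k * indicator {r k<..r (Suc k)} s)\<^sup>2 \<partial>lborel)
       = (\<Sum>k<n. (e k)\<^sup>2 * (r (Suc k) - r k))"
proof -
  have [simp]: "integrable lborel (\<lambda>s. indicator {r k<..r (Suc k)} s :: real)" if "k < n" for k
    using r[OF that] by (intro integrable_real_indicator) auto
  have sq: "(\<Sum>k<n. e k * indicator {r k<..r (Suc k)} s)\<^sup>2
      = (\<Sum>k<n. (e k)\<^sup>2 * indicator {r k<..r (Suc k)} s)" for s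
    by (rule sum_indicator_power2) (rule r)
  show "integrable lborel (\<lambda>s. (\<Sum>k<n. e k * indicator {r k<..r (Suc k)} s)\<^sup>2)"
    unfolding sq by (intro Bochner_Integration.integrable_sum integrable_mult_right) simp
  show "(\<integral>s. (\<Sum>k<n. e k * indicator {r k<..r (Suc k)} s)\<^sup>2 \<partial>lborel)
       = (\<Sum>k<n. (e k)\<^sup>2 * (r (Suc k) - r k))"
    unfolding sq using r
    by (subst Bochner_Integration.integral_sum) (auto intro!: sum.cong)
qed

lemma (in prob_space) gaussian_law_sum_indep_normal:
  fixes e \<sigma> :: "'i \<Rightarrow> real"
  assumes fin: "finite I" and ind: "indep_vars (\<lambda>_. borel) Z I"
    and \<sigma>: "\<And>i. i \<in> I \<Longrightarrow> 0 < \<sigma> i"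
    and Z: "\<And>i. i \<in> I \<Longrightarrow> distributed M lborel (Z i) (normal_density 0 (\<sigma> i))"
  shows "gaussian_law M (\<lambda>\<omega>. \<Sum>i\<in>I. e i * Z i \<omega>) (\<Sum>i\<in>I. (e i * \<sigma> i)\<^sup>2)"
proof -
  \<comment> \<open>A term with coefficient 0 has no normal density, so such terms are dropped
    before the addition theorem for independent normal variables is used. If none remain, the law is
    degenerate.\<close>
  define J where "J = {i \<in> I. e i \<noteq> 0}"
  have J: "finite J" "J \<subseteq> I" using fin by (auto simp: J_def)
  have "(\<lambda>\<omega>. \<Sum>i\<in>I. e i * Z i \<omega>) = (\<lambda>\<omega>. \<Sum>i\<in>J. e i * Z i \<omega>)"
    by (intro ext sum.mono_neutral_right) (use fin in \<open>auto simp: J_def\<close>)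
  moreover have "(\<Sum>i\<in>I. (e i * \<sigma> i)\<^sup>2) = (\<Sum>i\<in>J. (e i * \<sigma> i)\<^sup>2)"
    by (intro sum.mono_neutral_right) (use fin in \<open>auto simp: J_def\<close>)
  moreover have "gaussian_law M (\<lambda>\<omega>. \<Sum>i\<in>J. e i * Z i \<omega>) (\<Sum>i\<in>J. (e i * \<sigma> i)\<^sup>2)"
  proof (cases "J = {}")
    case False
    have pos: "0 < \<bar>e i\<bar> * \<sigma> i" if "i \<in> J" for i using that \<sigma> by (auto simp: J_def)
    have "indep_vars (\<lambda>_. borel) (\<lambda>i \<omega>. e i * Z i \<omega>) J"
      by (rule indep_vars_compose2[OF indep_vars_subset[OF ind J(2)]]) measurable
    moreover have "distributed M lborel (\<lambda>\<omega>. e i * Z i \<omega>) (normal_density 0 (\<bar>e i\<bar> * \<sigma> i))"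
      if "i \<in> J" for i
      using that normal_density_affine[OF Z \<sigma>, of i "e i" 0] by (auto simp: J_def)
    ultimately have "distributed M lborel (\<lambda>\<omega>. \<Sum>i\<in>J. e i * Z i \<omega>)
        (normal_density (\<Sum>i\<in>J. 0) (sqrt (\<Sum>i\<in>J. (\<bar>e i\<bar> * \<sigma> i)\<^sup>2)))"
      by (intro sum_indep_normal J(1) False pos)
    moreover have "0 < (\<Sum>i\<in>J. (\<bar>e i\<bar> * \<sigma> i)\<^sup>2)"
      by (intro sum_pos J(1) False zero_less_power pos)
    ultimately show ?thesis
      using gaussian_law_normal[of "sqrt (\<Sum>i\<in>J. (\<bar>e i\<bar> * \<sigma> i)\<^sup>2)"] by (simp add: power_mult_distrib)
  qed (simp add: gaussian_law_zero)
  ultimately show ?thesis by simp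
qed

section \<open>Gaussian laws and the Ito isometry for Wiener integrals\<close>

context wiener_process
begin

text \<open>The intervals may overlap, so their increments need not be independent. On the common
  refinement of all endpoints they become combinations of independent increments, and the variance
  of the sum is the squared norm of the step function with the same coefficients.\<close>

lemma gaussian_law_sum_increments:
  fixes c u v :: "'i \<Rightarrow> real"
  assumes fin: "finite I" and uv: "\<And>i. i \<in> I \<Longrightarrow> 0 \<le> u i \<and> u i \<le> v i \<and> v i \<le> 1"
  defines "\<phi> \<equiv> \<lambda>s. \<Sum>i\<in>I. c i * indicator {u i<..v i} s"
  shows "integrable lborel (\<lambda>s. (\<phi> s)\<^sup>2)"
    and "gaussian_law M (\<lambda>\<omega>. \<Sum>i\<in>I. c i * (W (v i) \<omega> - W (u i) \<omega>)) (\<integral>s. (\<phi> s)\<^sup>2 \<partial>lborel)"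
proof -
  \<comment> \<open>The point 0 keeps the set of nodes nonempty when \<open>I\<close> is
    empty.\<close>
  obtain n r where r: "\<And>k. k \<le> n \<Longrightarrow> r k \<in> insert 0 (u ` I \<union> v ` I)"
      "\<And>k. k < n \<Longrightarrow> r k < r (Suc k)"
    and ref: "\<And>a b (g :: real \<Rightarrow> real). a \<in> insert 0 (u ` I \<union> v ` I) \<Longrightarrow> b \<in> insert 0 (u ` I \<union> v ` I) \<Longrightarrow> a \<le> b \<Longrightarrow>
       g b - g a = (\<Sum>k<n. of_bool (a \<le> r k \<and> r k < b) * (g (r (Suc k)) - g (r k)))"
    by (rule finite_refinement[of "insert 0 (u ` I \<union> v ` I)"]) (use fin in auto)
  have r01: "r k \<in> {0..1}" if "k \<le> n" for k
    using r(1)[OF that] uv by force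
  \<comment> \<open>The coefficient of a cell collects the weights of all intervals that contain
    it.\<close>
  define e where "e k = (\<Sum>i\<in>I. c i * of_bool (u i \<le> r k \<and> r k < v i))" for k
  \<comment> \<open>Taking \<open>g\<close> to be a path of \<open>W\<close> or \<open>indicator {s..}\<close> refines the random sum and \<open>\<phi>\<close> alike.\<close>
  have regroup: "(\<Sum>i\<in>I. c i * (g (v i) - g (u i))) = (\<Sum>k<n. e k * (g (r (Suc k)) - g (r k)))"
    for g :: "real \<Rightarrow> real"
  proof -
    have "(\<Sum>i\<in>I. c i * (g (v i) - g (u i)))
        = (\<Sum>i\<in>I. c i * (\<Sum>k<n. of_bool (u i \<le> r k \<and> r k < v i) * (g (r (Suc k)) - g (r k))))"
      by (intro sum.cong arg_cong2[of _ _ _ _ "(*)"] refl ref) (use uv in auto)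
    also have "\<dots> = (\<Sum>k<n. e k * (g (r (Suc k)) - g (r k)))"
      unfolding e_def sum_distrib_left sum_distrib_right mult.assoc[symmetric] by (rule sum.swap)
    finally show ?thesis .
  qed
  have \<phi>: "\<phi> s = (\<Sum>k<n. e k * indicator {r k<..r (Suc k)} s)" for s
    using regroup[of "indicator {s..}"] uv r(2)
    by (simp add: \<phi>_def indicator_greaterThanAtMost_eq_diff less_imp_le)
  show "integrable lborel (\<lambda>s. (\<phi> s)\<^sup>2)"
    unfolding \<phi> by (rule integral_sum_indicator_power2) (use r(2) less_imp_le in blast)
  have "gaussian_law M (\<lambda>\<omega>. \<Sum>k<n. e k * (W (r (Suc k)) \<omega> - W (r k) \<omega>))
      (\<Sum>k<n. (e k * sqrt (r (Suc k) - r k))\<^sup>2)"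
  proof (rule gaussian_law_sum_indep_normal)
    show "indep_vars (\<lambda>_. borel) (\<lambda>k \<omega>. W (r (Suc k)) \<omega> - W (r k) \<omega>) {..<n}"
      using indep_increments r01 r(2) by blast
    show "distributed M lborel (\<lambda>\<omega>. W (r (Suc k)) \<omega> - W (r k) \<omega>)
        (normal_density 0 (sqrt (r (Suc k) - r k)))" if "k \<in> {..<n}" for k
      using that r01[of k] r01[of "Suc k"] r(2)[of k] by (intro normal_increments) auto
  qed (use r(2) in auto)
  also have "(\<lambda>\<omega>. \<Sum>k<n. e k * (W (r (Suc k)) \<omega> - W (r k) \<omega>))
      = (\<lambda>\<omega>. \<Sum>i\<in>I. c i * (W (v i) \<omega> - W (u i) \<omega>))"
    using regroup[of "\<lambda>t. W t \<omega>" for \<omega>] by simp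
  also have "(\<Sum>k<n. (e k * sqrt (r (Suc k) - r k))\<^sup>2) = (\<integral>s. (\<phi> s)\<^sup>2 \<partial>lborel)"
    unfolding \<phi> using r(2) by (subst integral_sum_indicator_power2) (simp_all add: less_imp_le power_mult_distrib)
  finally show "gaussian_law M (\<lambda>\<omega>. \<Sum>i\<in>I. c i * (W (v i) \<omega> - W (u i) \<omega>)) (\<integral>s. (\<phi> s)\<^sup>2 \<partial>lborel)" .
qed

text \<open>Each integral has its own approximating step functions, on unrelated partitions. For
  each \<open>m\<close> the combined step integrals are again a weighted sum of increments of
  \<open>W\<close>, so the previous lemma applies to them, and both sides pass to the mean-square
  limit. Extending each \<open>f i\<close> by 0 outside \<open>{0..\<tau> i}\<close> places all
  integrands in one space over the whole line.\<close>

lemma gaussian_law_sum_wiener_integral: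
  fixes b \<tau> :: "'i \<Rightarrow> real"
  assumes fin: "finite I" and \<tau>: "\<And>i. i \<in> I \<Longrightarrow> \<tau> i \<in> {0..1}"
    and X: "\<And>i. i \<in> I \<Longrightarrow> has_wiener_integral M W 0 (\<tau> i) (f i) (Y i)"
  defines "\<phi> \<equiv> \<lambda>s. \<Sum>i\<in>I. b i * (indicator {0..\<tau> i} s * f i s)"
  shows "integrable lborel (\<lambda>s. (\<phi> s)\<^sup>2)"
    and "gaussian_law M (\<lambda>\<omega>. \<Sum>i\<in>I. b i * Y i \<omega>) (\<integral>s. (\<phi> s)\<^sup>2 \<partial>lborel)"
proof -
  from X have [measurable]: "\<And>i. i \<in> I \<Longrightarrow> Y i \<in> borel_measurable M"
      "\<And>i. i \<in> I \<Longrightarrow> (\<lambda>s. indicator {0..\<tau> i} s * f i s) \<in> borel_measurable lborel"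
    by (auto simp: has_wiener_integral_def set_borel_measurable_def)
  have "\<forall>i\<in>I. \<exists>N p c.
        (\<forall>m. (\<forall>k\<le>N m. p m k \<in> {0..\<tau> i}) \<and> (\<forall>k<N m. p m k \<le> p m (Suc k))) \<and>
        (\<lambda>m. \<integral>\<^sup>+s\<in>{0..\<tau> i}. ennreal ((f i s - step_fun (N m) (p m) (c m) s)\<^sup>2) \<partial>lborel) \<longlonglongrightarrow> 0 \<and>
        (\<lambda>m. \<integral>\<^sup>+\<omega>. ennreal ((Y i \<omega> - step_wiener_integral W (N m) (p m) (c m) \<omega>)\<^sup>2) \<partial>M)
          \<longlonglongrightarrow> 0"
    using X by (simp add: has_wiener_integral_def)
  then obtain N p c where *: "\<forall>i\<in>I.
        (\<forall>m. (\<forall>k\<le>N i m. p i m k \<in> {0..\<tau> i}) \<and> (\<forall>k<N i m. p i m k \<le> p i m (Suc k))) \<and>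
        (\<lambda>m. \<integral>\<^sup>+s\<in>{0..\<tau> i}. ennreal ((f i s - step_fun (N i m) (p i m) (c i m) s)\<^sup>2) \<partial>lborel) \<longlonglongrightarrow> 0 \<and>
        (\<lambda>m. \<integral>\<^sup>+\<omega>. ennreal ((Y i \<omega> - step_wiener_integral W (N i m) (p i m) (c i m) \<omega>)\<^sup>2) \<partial>M)
          \<longlonglongrightarrow> 0"
    unfolding bchoice_iff by blast
  then have p: "\<And>i m k. i \<in> I \<Longrightarrow> k \<le> N i m \<Longrightarrow> p i m k \<in> {0..\<tau> i}"
       "\<And>i m k. i \<in> I \<Longrightarrow> k < N i m \<Longrightarrow> p i m k \<le> p i m (Suc k)"
    and f_lim: "\<And>i. i \<in> I \<Longrightarrow>
      (\<lambda>m. \<integral>\<^sup>+s\<in>{0..\<tau> i}. ennreal ((f i s - step_fun (N i m) (p i m) (c i m) s)\<^sup>2) \<partial>lborel) \<longlonglongrightarrow> 0"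
    and Y_lim: "\<And>i. i \<in> I \<Longrightarrow>
      (\<lambda>m. \<integral>\<^sup>+\<omega>. ennreal ((Y i \<omega> - step_wiener_integral W (N i m) (p i m) (c i m) \<omega>)\<^sup>2) \<partial>M) \<longlonglongrightarrow> 0"
    by blast+
  define \<phi>' where "\<phi>' m s = (\<Sum>i\<in>I. b i * step_fun (N i m) (p i m) (c i m) s)" for m s
  define S where "S m \<omega> = (\<Sum>i\<in>I. b i * step_wiener_integral W (N i m) (p i m) (c i m) \<omega>)" for m \<omega>
  have [measurable]: "step_fun n q d \<in> borel_measurable lborel" for n q d
    unfolding step_fun_def by measurable
  have [measurable]: "W (p i m k) \<in> borel_measurable M" if "i \<in> I" "k \<le> N i m" for i m k
    using p(1)[OF that] \<tau>[OF that(1)] by (intro rv) auto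
  have [measurable]: "step_wiener_integral W (N i m) (p i m) (c i m) \<in> borel_measurable M" if "i \<in> I" for i m
    unfolding step_wiener_integral_def using that by (auto simp: Suc_le_eq)
  \<comment> \<open>The double sum is flattened to one sum over pairs \<open>(i, k)\<close>, since
    the number of cells depends on \<open>i\<close>.\<close>
  have Sigma: "(\<Sum>i\<in>I. b i * (\<Sum>k<N i m. h i k)) = (\<Sum>(i, k)\<in>Sigma I (\<lambda>i. {..<N i m}). b i * h i k)"
    for h :: "'i \<Rightarrow> nat \<Rightarrow> real" and m
    using fin by (simp add: sum.Sigma sum_distrib_left)
  let ?J = "\<lambda>m. Sigma I (\<lambda>i. {..<N i m})"
  let ?c = "\<lambda>m (i, k). b i * c i m k" and ?u = "\<lambda>m (i, k). p i m k" and ?v = "\<lambda>m (i, k). p i m (Suc k)"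
  have \<phi>'_eq: "\<phi>' m s = (\<Sum>j\<in>?J m. ?c m j * indicator {?u m j<..?v m j} s)" for m s
    by (simp add: \<phi>'_def step_fun_def Sigma split_beta mult.assoc del: sum_mult_indicator)
  have S_eq: "S m \<omega> = (\<Sum>j\<in>?J m. ?c m j * (W (?v m j) \<omega> - W (?u m j) \<omega>))" for m \<omega>
    by (simp add: S_def step_wiener_integral_def Sigma split_beta mult.assoc)
  have uv: "0 \<le> ?u m j \<and> ?u m j \<le> ?v m j \<and> ?v m j \<le> 1" if j: "j \<in> ?J m" for m j
  proof -
    obtain i k where "j = (i, k)" "i \<in> I" "k < N i m" using j by auto
    then show ?thesis using p(1)[of i k m] p(1)[of i "Suc k" m] p(2)[of i k m] \<tau>[of i] by auto
  qed
  have int_\<phi>': "integrable lborel (\<lambda>s. (\<phi>' m s)\<^sup>2)" for m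
    unfolding \<phi>'_eq by (rule gaussian_law_sum_increments) (use fin uv in auto)
  have law_S: "gaussian_law M (S m) (\<integral>s. (\<phi>' m s)\<^sup>2 \<partial>lborel)" for m
    unfolding \<phi>'_eq S_eq[abs_def] by (rule gaussian_law_sum_increments) (use fin uv in auto)
  have "(\<lambda>m. \<integral>\<^sup>+s. ennreal ((indicator {0..\<tau> i} s * f i s - step_fun (N i m) (p i m) (c i m) s)\<^sup>2) \<partial>lborel)
      \<longlonglongrightarrow> 0" if i: "i \<in> I" for i
  proof -
    \<comment> \<open>All nodes lie in \<open>{0..\<tau> i}\<close>, so the step function vanishes
      outside, as does the extended \<open>f i\<close>; the distance over the interval is therefore
      the distance over the line.\<close>
    have "step_fun (N i m) (p i m) (c i m) s = 0" if s: "s \<notin> {0..\<tau> i}" for m s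
      unfolding step_fun_def
    proof (intro sum.neutral ballI)
      fix k assume "k \<in> {..<N i m}"
      then show "c i m k * indicator {p i m k<..p i m (Suc k)} s = 0"
        using p(1)[OF i, of k m] p(1)[OF i, of "Suc k" m] s by (auto simp: indicator_def)
    qed
    then have "ennreal ((indicator {0..\<tau> i} s * f i s - step_fun (N i m) (p i m) (c i m) s)\<^sup>2)
        = ennreal ((f i s - step_fun (N i m) (p i m) (c i m) s)\<^sup>2) * indicator {0..\<tau> i} s" for m s
      by (cases "s \<in> {0..\<tau> i}") auto
    then show ?thesis using f_lim[OF i] by simp
  qed
  from L2_tendsto_sum[OF _ this, where b = b]
  have "(\<lambda>m. \<integral>\<^sup>+s. ennreal ((\<phi> s - \<phi>' m s)\<^sup>2) \<partial>lborel) \<longlonglongrightarrow> 0"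
    by (simp add: \<phi>_def \<phi>'_def sum_subtractf right_diff_distrib)
  moreover have [measurable]: "\<phi> \<in> borel_measurable lborel" "\<phi>' m \<in> borel_measurable lborel" for m
    unfolding \<phi>_def \<phi>'_def[abs_def] by measurable
  ultimately have int_\<phi>: "integrable lborel (\<lambda>s. (\<phi> s)\<^sup>2)"
    and \<phi>_lim: "(\<lambda>m. \<integral>s. (\<phi>' m s)\<^sup>2 \<partial>lborel) \<longlonglongrightarrow> (\<integral>s. (\<phi> s)\<^sup>2 \<partial>lborel)"
    by (auto intro!: L2_limit_integrable[where g = \<phi>'] L2_limit_integral int_\<phi>')
  show "integrable lborel (\<lambda>s. (\<phi> s)\<^sup>2)" by (rule int_\<phi>)
  have "(\<lambda>m. \<integral>\<^sup>+\<omega>. ennreal (((\<Sum>i\<in>I. b i * Y i \<omega>) - S m \<omega>)\<^sup>2) \<partial>M) \<longlonglongrightarrow> 0"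
    using L2_tendsto_sum[OF _ Y_lim, where b = b]
    by (simp add: S_def sum_subtractf right_diff_distrib)
  then show "gaussian_law M (\<lambda>\<omega>. \<Sum>i\<in>I. b i * Y i \<omega>) (\<integral>s. (\<phi> s)\<^sup>2 \<partial>lborel)"
    by (intro gaussian_law_L2_limit[OF _ law_S _ \<phi>_lim]) auto
qed

end

text \<open>All nodes coincide, so every step integral is 0 and the constant sequence of second
  moments of \<open>Y\<close> tends to 0. This yields the initial condition for the Volterra
  process.\<close>

lemma wiener_integral_degenerate:
  assumes "has_wiener_integral M W a a f Y"
  shows "AE \<omega> in M. Y \<omega> = 0"
proof -
  obtain N :: "nat \<Rightarrow> nat" and p c where *: "\<forall>m. (\<forall>k\<le>N m. p m k \<in> {a..a}) \<and> (\<forall>k<N m. p m k \<le> p m (Suc k))"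
    and lim: "(\<lambda>m. \<integral>\<^sup>+\<omega>. ennreal ((Y \<omega> - step_wiener_integral W (N m) (p m) (c m) \<omega>)\<^sup>2) \<partial>M) \<longlonglongrightarrow> 0"
    and [measurable]: "Y \<in> borel_measurable M"
    using assms unfolding has_wiener_integral_def by blast
  from * have p: "p m k = a" if "k \<le> N m" for m k using that by auto
  have "step_wiener_integral W (N m) (p m) (c m) \<omega> = 0" for m \<omega>
    by (auto simp: step_wiener_integral_def p Suc_le_eq intro!: sum.neutral)
  with lim have "(\<integral>\<^sup>+\<omega>. ennreal ((Y \<omega>)\<^sup>2) \<partial>M) = 0"
    by (simp add: LIMSEQ_const_iff)
  then show ?thesis by (subst (asm) nn_integral_0_iff_AE) (auto simp: ennreal_eq_0_iff)
qed


section \<open>Pointwise estimate of the combined kernel increments\<close>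

lemma continuous_on_compact_bound_real:
  fixes f :: "'a::topological_space \<Rightarrow> real"
  assumes "compact S" "continuous_on S f"
  obtains B where "0 < B" "\<And>x. x \<in> S \<Longrightarrow> \<bar>f x\<bar> \<le> B"
proof -
  have "bounded (f ` S)" using assms by (intro compact_imp_bounded compact_continuous_image)
  then obtain B where "0 < B" "\<forall>x\<in>f ` S. norm x \<le> B" by (auto simp: bounded_pos)
  then show thesis by (intro that) auto
qed

text \<open>Here \<open>s\<close> is fixed and \<open>k\<close> is the section of the kernel at
  \<open>s\<close>. The bound is shaped for integration over \<open>s\<close> in
  \<open>{0..1}\<close>: the first sum integrates to the second, which is constant in
  \<open>s\<close>.\<close>

lemma sum_increments_power2_le:
  fixes a t :: "nat \<Rightarrow> real" and k :: "real \<Rightarrow> real"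
  assumes t: "t 0 = 0" "t n = 1" "\<And>j. j < n \<Longrightarrow> t j \<le> t (Suc j)"
    and s: "s \<in> {0..1}"
    and B: "\<And>u. u \<in> {0..1} \<Longrightarrow> \<bar>k u\<bar> \<le> B"
    and D: "\<And>u v. u \<in> {0..1} \<Longrightarrow> v \<in> {0..1} \<Longrightarrow> \<bar>k u - k v\<bar> \<le> D * \<bar>u - v\<bar>"
  shows "(\<Sum>j<n. a j * (indicator {0..t (Suc j)} s * k (t (Suc j)) - indicator {0..t j} s * k (t j)))\<^sup>2
    \<le> 2 * B\<^sup>2 * (\<Sum>j<n. (a j)\<^sup>2 * indicator {t j<..t (Suc j)} s)
      + 2 * D\<^sup>2 * (\<Sum>j<n. (a j)\<^sup>2 * (t (Suc j) - t j))"
    (is "?S\<^sup>2 \<le> 2 * B\<^sup>2 * ?P + 2 * D\<^sup>2 * ?Q")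
proof -
  have t01: "t j \<in> {0..1}" if "j \<le> n" for j
    using mono_upto[of n t 0 j] mono_upto[of n t j n] t that by auto
  let ?A = "\<Sum>j<n. (a j * k (t (Suc j))) * indicator {t j<..t (Suc j)} s"
  let ?R = "\<Sum>j<n. a j * (indicator {0..t j} s * (k (t (Suc j)) - k (t j)))"
  \<comment> \<open>Since \<open>0 \<le> s\<close>, the indicator of \<open>{0..t (Suc j)}\<close>
    at \<open>s\<close> is the sum of those of \<open>{0..t j}\<close> and
    \<open>{t j<..t (Suc j)}\<close>.\<close>
  have "?S = ?A + ?R"
    unfolding sum.distrib[symmetric]
  proof (rule sum.cong)
    fix j assume "j \<in> {..<n}"
    then show "a j * (indicator {0..t (Suc j)} s * k (t (Suc j)) - indicator {0..t j} s * k (t j))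
      = a j * k (t (Suc j)) * indicator {t j<..t (Suc j)} s
        + a j * (indicator {0..t j} s * (k (t (Suc j)) - k (t j)))"
      using s t(3)[of j] by (auto simp: indicator_def algebra_simps)
  qed simp
  moreover have "(x + y)\<^sup>2 \<le> 2 * x\<^sup>2 + 2 * y\<^sup>2" for x y :: real
    using zero_le_power2[of "x - y"] by (simp add: power2_eq_square algebra_simps)
  ultimately have "?S\<^sup>2 \<le> 2 * ?A\<^sup>2 + 2 * ?R\<^sup>2" by simp
  moreover have "?A\<^sup>2 \<le> B\<^sup>2 * ?P"
  proof -
    have sq: "?A\<^sup>2 = (\<Sum>j<n. (a j * k (t (Suc j)))\<^sup>2 * indicator {t j<..t (Suc j)} s)"
      by (rule sum_indicator_power2) (rule t(3))
    have "(k (t (Suc j)))\<^sup>2 \<le> B\<^sup>2" if "j < n" for j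
      using power_mono[OF B[OF t01[of "Suc j"]], of 2] that by simp
    then show ?thesis
      unfolding sq sum_distrib_left
      by (intro sum_mono) (auto simp: power_mult_distrib indicator_def mult.commute[of "B\<^sup>2"] intro!: mult_left_mono)
  qed
  moreover have "?R\<^sup>2 \<le> D\<^sup>2 * ?Q"
  proof -
    let ?d = "\<lambda>j. t (Suc j) - t j"
    have d: "0 \<le> ?d j" if "j < n" for j using t(3)[OF that] by simp
    have "\<bar>?R\<bar> \<le> (\<Sum>j<n. \<bar>a j\<bar> * (D * ?d j))"
    proof (rule order_trans[OF sum_abs sum_mono])
      fix j assume j: "j \<in> {..<n}"
      have "\<bar>k (t (Suc j)) - k (t j)\<bar> \<le> D * ?d j"
        using D[OF t01[of "Suc j"] t01[of j]] d[of j] j by simp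
      then have "\<bar>indicator {0..t j} s * (k (t (Suc j)) - k (t j))\<bar> \<le> D * ?d j"
        by (auto simp: indicator_def)
      then show "\<bar>a j * (indicator {0..t j} s * (k (t (Suc j)) - k (t j)))\<bar> \<le> \<bar>a j\<bar> * (D * ?d j)"
        unfolding abs_mult[of "a j"] by (rule mult_left_mono) simp
    qed
    \<comment> \<open>Each length is split into two square roots: Cauchy-Schwarz then leaves
      \<open>?Q\<close> in one factor and the total length \<open>t n - t 0 = 1\<close> in the
      other.\<close>
    also have "\<dots> = D * (\<Sum>j<n. (\<bar>a j\<bar> * sqrt (?d j)) * sqrt (?d j))"
      unfolding sum_distrib_left using d by (intro sum.cong) auto
    finally have "\<bar>?R\<bar>\<^sup>2 \<le> (D * (\<Sum>j<n. (\<bar>a j\<bar> * sqrt (?d j)) * sqrt (?d j)))\<^sup>2"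
      by (rule power_mono) simp
    then have "?R\<^sup>2 \<le> D\<^sup>2 * (\<Sum>j<n. (\<bar>a j\<bar> * sqrt (?d j)) * sqrt (?d j))\<^sup>2"
      unfolding power2_abs power_mult_distrib .
    also have "\<dots> \<le> D\<^sup>2 * ((\<Sum>j<n. (\<bar>a j\<bar> * sqrt (?d j))\<^sup>2) * (\<Sum>j<n. (sqrt (?d j))\<^sup>2))"
      by (intro mult_left_mono Cauchy_Schwarz_ineq_sum) simp
    also have "(\<Sum>j<n. (sqrt (?d j))\<^sup>2) = 1"
      using d t(1,2) sum_lessThan_telescope[of t n] by simp
    also have "(\<Sum>j<n. (\<bar>a j\<bar> * sqrt (?d j))\<^sup>2) = ?Q"
      using d by (intro sum.cong) (auto simp: power_mult_distrib)
    finally show ?thesis by simp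
  qed
  ultimately show ?thesis by (simp add: algebra_simps)
qed

section \<open>The integrator inequality for the Volterra process\<close>

theorem theorem2p1:
  fixes K :: "real \<Rightarrow> real \<Rightarrow> real"
    and M :: "'a measure"
    and W X :: "real \<Rightarrow> 'a \<Rightarrow> real"
  assumes K_continuous: "continuous_on ({0..1} \<times> {0..1}) (\<lambda>(t, s). K t s)"
    and K_C1_in_t: "\<exists>dK :: real \<Rightarrow> real \<Rightarrow> real.
        (\<forall>t\<in>{0..1}. \<forall>s\<in>{0..1}.
           ((\<lambda>u. K u s) has_real_derivative dK t s) (at t within {0..1})) \<and>
        continuous_on ({0..1} \<times> {0..1}) (\<lambda>(t, s). dK t s)"
    and W_wiener: "wiener_process M W"
    and X_volterra: "\<And>t. t \<in> {0..1} \<Longrightarrow> has_wiener_integral M W 0 t (K t) (X t)"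
  shows "integrator M X"
proof -
  interpret wiener_process M W by (rule W_wiener)
  have square: "compact ({0..1} \<times> {0..1} :: (real \<times> real) set)" by (intro compact_Times) auto
  obtain B where B: "0 < B" "\<And>t s. t \<in> {0..1} \<Longrightarrow> s \<in> {0..1} \<Longrightarrow> \<bar>K t s\<bar> \<le> B"
    by (rule continuous_on_compact_bound_real[OF square K_continuous]) auto
  obtain dK where dK: "\<And>t s. t \<in> {0..1} \<Longrightarrow> s \<in> {0..1} \<Longrightarrow>
        ((\<lambda>u. K u s) has_real_derivative dK t s) (at t within {0..1})"
    and dK_cont: "continuous_on ({0..1} \<times> {0..1}) (\<lambda>(t, s). dK t s)"
    using K_C1_in_t by blast
  obtain D where D: "0 < D" "\<And>t s. t \<in> {0..1} \<Longrightarrow> s \<in> {0..1} \<Longrightarrow> \<bar>dK t s\<bar> \<le> D"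
    by (rule continuous_on_compact_bound_real[OF square dK_cont]) auto
  \<comment> \<open>Mean value inequality on the convex set \<open>{0..1}\<close>, where derivatives
    within the set suffice at the endpoints.\<close>
  have K_lipschitz: "\<bar>K u s - K v s\<bar> \<le> D * \<bar>u - v\<bar>"
    if "u \<in> {0..1}" "v \<in> {0..1}" "s \<in> {0..1}" for u v s
    using field_differentiable_bound[of "{0..1}" "\<lambda>u. K u s" "\<lambda>t. dK t s" D u v] dK D(2) that by simp
  show ?thesis
    unfolding integrator_def
  proof (intro conjI)
    have "centred_gaussian M (\<lambda>\<omega>. \<Sum>t\<in>F. a t * X t \<omega>)" if "finite F" "F \<subseteq> {0..1}" for F a
      by (rule gaussian_law_imp_centred_gaussian,
          rule gaussian_law_sum_wiener_integral(2)[where \<tau> = "\<lambda>t. t" and f = K])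
        (use that X_volterra in auto)
    then show "centred_gaussian_process M {0..1} X"
      by (simp add: centred_gaussian_process_def prob_space_axioms)
    show "AE \<omega> in M. X 0 \<omega> = 0"
      by (rule wiener_integral_degenerate[OF X_volterra]) simp
    show "\<exists>c>0. \<forall>n\<ge>1. \<forall>(a :: nat \<Rightarrow> real) (t :: nat \<Rightarrow> real).
        t 0 = 0 \<and> t n = 1 \<and> (\<forall>k<n. t k < t (Suc k)) \<longrightarrow>
          (\<integral>\<omega>. (\<Sum>k<n. a k * (X (t (Suc k)) \<omega> - X (t k) \<omega>))\<^sup>2 \<partial>M)
            \<le> c * (\<Sum>k<n. (a k)\<^sup>2 * (t (Suc k) - t k))"
    proof (intro exI[of _ "2 * B\<^sup>2 + 2 * D\<^sup>2"] conjI allI impI)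
      show "0 < 2 * B\<^sup>2 + 2 * D\<^sup>2" using B(1) by (simp add: add_pos_nonneg)
      fix n :: nat and a t :: "nat \<Rightarrow> real"
      assume "t 0 = 0 \<and> t n = 1 \<and> (\<forall>k<n. t k < t (Suc k))"
      then have t: "t 0 = 0" "t n = 1" "\<And>k. k < n \<Longrightarrow> t k \<le> t (Suc k)" by (auto intro: less_imp_le)
      \<comment> \<open>An increment contributes two values of the process with opposite signs; the
        boolean picks the endpoint. This turns the sum of increments into a combination of values
        \<open>X (\<tau> i)\<close>, in which a time may occur under several indices.\<close>
      let ?I = "{..<n} \<times> (UNIV :: bool set)"
      define b where "b = (\<lambda>(k, z). if z then a k else - a k)"
      define \<tau> where "\<tau> = (\<lambda>(k, z). if z then t (Suc k) else t k)"
      have regroup: "(\<Sum>i\<in>?I. b i * g (\<tau> i)) = (\<Sum>k<n. a k * (g (t (Suc k)) - g (t k)))"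
        for g :: "real \<Rightarrow> real"
        by (simp add: sum.cartesian_product' UNIV_bool b_def \<tau>_def right_diff_distrib)
      have \<tau>: "\<tau> i \<in> {0..1}" if "i \<in> ?I" for i
      proof -
        obtain k z where "i = (k, z)" "k < n" using \<open>i \<in> ?I\<close> by auto
        then show ?thesis
          using mono_upto[of n t 0 "Suc k"] mono_upto[of n t "Suc k" n] mono_upto[of n t 0 k]
            mono_upto[of n t k n] t by (auto simp: \<tau>_def)
      qed
      let ?\<phi> = "\<lambda>s. \<Sum>k<n. a k * (indicator {0..t (Suc k)} s * K (t (Suc k)) s - indicator {0..t k} s * K (t k) s)"
      let ?Q = "\<Sum>k<n. (a k)\<^sup>2 * (t (Suc k) - t k)"
      \<comment> \<open>The constant term is cut off by \<open>indicator {0..1}\<close> to make the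
        majorant integrable over the line; its integral is
        \<open>(2 * B\<^sup>2 + 2 * D\<^sup>2) * ?Q\<close>, which explains the constant.\<close>
      let ?h = "\<lambda>s. 2 * B\<^sup>2 * (\<Sum>k<n. (a k)\<^sup>2 * indicator {t k<..t (Suc k)} s) + 2 * D\<^sup>2 * ?Q * indicator {0..1} s"
      have \<phi>: "(\<Sum>i\<in>?I. b i * (indicator {0..\<tau> i} s * K (\<tau> i) s)) = ?\<phi> s" for s
        by (rule regroup)
      have "integrable lborel (\<lambda>s. (?\<phi> s)\<^sup>2)"
        and law: "gaussian_law M (\<lambda>\<omega>. \<Sum>k<n. a k * (X (t (Suc k)) \<omega> - X (t k) \<omega>)) (\<integral>s. (?\<phi> s)\<^sup>2 \<partial>lborel)"
        using gaussian_law_sum_wiener_integral[of ?I \<tau> "\<lambda>i. K (\<tau> i)" "\<lambda>i. X (\<tau> i)" b, OF _ \<tau> X_volterra[OF \<tau>]]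
        unfolding \<phi> regroup[of "\<lambda>u. X u \<omega>" for \<omega>] by auto
      \<comment> \<open>By disjointness this sum is the square of the step function with
        coefficients \<open>a k\<close>, whose integral is known.\<close>
      have h_int: "integrable lborel (\<lambda>s. \<Sum>k<n. (a k)\<^sup>2 * indicator {t k<..t (Suc k)} s)"
          "(\<integral>s. (\<Sum>k<n. (a k)\<^sup>2 * indicator {t k<..t (Suc k)} s) \<partial>lborel) = ?Q"
        using integral_sum_indicator_power2[of n t a] t(3)
        by (simp_all add: sum_indicator_power2 del: sum_mult_indicator)
      have "(\<integral>\<omega>. (\<Sum>k<n. a k * (X (t (Suc k)) \<omega> - X (t k) \<omega>))\<^sup>2 \<partial>M) = (\<integral>s. (?\<phi> s)\<^sup>2 \<partial>lborel)"
        using law by (simp add: gaussian_law_def)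
      also have "\<dots> \<le> (\<integral>s. ?h s \<partial>lborel)"
      proof (rule integral_mono)
        fix s :: real
        show "(?\<phi> s)\<^sup>2 \<le> ?h s"
        proof (cases "s \<in> {0..1}")
          case True
          then show ?thesis
            using sum_increments_power2_le[of t n s "\<lambda>u. K u s" B D a] t B(2) K_lipschitz by simp
        next
          case False
          \<comment> \<open>Every time involved lies in \<open>{0..1}\<close>, so all the indicators
            \<open>{0..t k}\<close> vanish at such \<open>s\<close>.\<close>
          then have "?\<phi> s = 0"
            using \<tau>[of "(k, z)" for k z] by (intro sum.neutral) (force simp: \<tau>_def indicator_def split: if_splits)
          then show ?thesis using False by (simp add: sum_nonneg)
        qed
      qed (use h_int in \<open>auto intro!: \<open>integrable lborel (\<lambda>s. (?\<phi> s)\<^sup>2)\<close>\<close>)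
      also have "\<dots> = (2 * B\<^sup>2 + 2 * D\<^sup>2) * ?Q"
        using h_int by (simp add: algebra_simps)
      finally show "(\<integral>\<omega>. (\<Sum>k<n. a k * (X (t (Suc k)) \<omega> - X (t k) \<omega>))\<^sup>2 \<partial>M)
          \<le> (2 * B\<^sup>2 + 2 * D\<^sup>2) * ?Q" .
    qed
  qed
qed

end
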